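(* Let $J$ be a categorical random variable taking values in $\{1,\dots,n\}$, and let $P^l$ and $P^{u-l}$ be the probability distributions of $J$ with $$P^l(J=j)=\frac{\hat\theta^l_{N,j}}{\sum_{i=1}^n\hat\theta^l_{N,i}},\qquad P^{u-l}(J=j)=\frac{\hat\theta^u_{N,j}-\hat\theta^l_{N,j}}{\sum_{i=1}^n(\hat\theta^u_{N,i}-\hat\theta^l_{N,i})}.$$ Define $\beta_N:=1-\dfrac{1-\sum_{j=1}^n\hat\theta^l_{N,j}}{\sum_{i=1}^n(\hat\theta^u_{N,i}-\hat\theta^l_{N,i})}$. Then, for any fixed $x\in\mathcal X$, $$\nu(x,\hat\theta_N,\hat r_N)=\Bigl(\sum_{j=1}^n\hat\theta^l_{N,j}\Bigr)\mathbb E_{P^l}\mathbb E_{Q_J}[\varphi(x,\xi)]+\Bigl(1-\sum_{j=1}^n\hat\theta^l_{N,j}\Bigr)\mathrm{CVaR}^{\beta_N}_{P^{u-l}}\mathbb E_{Q_J}[\varphi(x,\xi)],$$ where $\mathrm{CVaR}^{\beta_N}_{P^{u-l}}\mathbb E_{Q_J}[\varphi(x,\xi)]$ is the conditional value-at-risk of the random variable $\mathbb E_{Q_J}[\varphi(x,\xi)]$ (a function of $J$) under $J\sim P^{u-l}$ at risk level $\beta_N$.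
   Context: $\mathcal X\subseteq\mathbb R^d$ is nonempty closed convex; $Q_1,\dots,Q_n$ are fixed probability distributions on $\Xi\subseteq\mathbb R^m$; $\varphi:\mathcal X\times\Xi\to\mathbb R$ is continuous in $x$ and measurable and $Q_j$-integrable in $\xi$ for each $j$. $\Theta=\{\theta\in\mathbb R^n_+\mid\sum_j\theta_j=1\}$, $\hat\theta_N\in\Theta$, $\hat r_N\ge0$, $\hat\Theta_N=\{\theta\in\Theta\mid\|\theta-\hat\theta_N\|_\infty\le\hat r_N\}$, and $$\nu(x,\hat\theta_N,\hat r_N):=\max_{\theta\in\hat\Theta_N}\sum_{j=1}^n\theta_j\mathbb E_{Q_j}[\varphi(x,\xi)].$$ For $j=1,\dots,n$: $\hat\theta^l_{N,j}:=\max\{0,\hat\theta_{N,j}-\hat r_N\}$ and $\hat\theta^u_{N,j}:=\min\{1,\hat\theta_{N,j}+\hat r_N\}$. For a random variable $Z$ under distribution $P$ and $\beta\in[0,1)$, $\mathrm{CVaR}^\beta_P[Z]=\inf_{t\in\mathbb R}\{t+\frac1{1-\beta}\mathbb E_P[\max\{Z-t,0\}]\}$. Convention: if $\sum_j\hat\theta^l_{N,j}=0$ (respectively $\sum_j(\hat\theta^u_{N,j}-\hat\theta^l_{N,j})=0$), the corresponding term of the representation vanishes and $P^l$ (respectively $P^{u-l}$) may be chosen arbitrarily. *)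

theory Defs
  imports "HOL-Probability.Probability"
begin

definition prob_simplex :: "(real ^ 'n) set" where
  "prob_simplex = {\<theta>. (\<forall>j. 0 \<le> \<theta> $ j) \<and> (\<Sum>j\<in>UNIV. \<theta> $ j) = 1}"

definition ambiguity_set :: "real ^ 'n \<Rightarrow> real \<Rightarrow> (real ^ 'n) set" where
  "ambiguity_set \<theta>h r = {\<theta> \<in> prob_simplex. infnorm (\<theta> - \<theta>h) \<le> r}"

definition mix_expectation ::
  "('n \<Rightarrow> 'b measure) \<Rightarrow> ('a \<Rightarrow> 'b \<Rightarrow> real) \<Rightarrow> 'a \<Rightarrow> real ^ 'n \<Rightarrow> real" where
  "mix_expectation Q \<phi> x \<theta> = (\<Sum>j\<in>UNIV. \<theta> $ j * (\<integral>\<xi>. \<phi> x \<xi> \<partial>Q j))"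

text \<open>The maximum of an infinite set of reals is rendered by \<open>GREATEST\<close>; the lemma
  \<open>worst_case_is_max\<close> below shows that it exists and is attained.\<close>

definition worst_case ::
  "('n \<Rightarrow> 'b measure) \<Rightarrow> ('a \<Rightarrow> 'b \<Rightarrow> real) \<Rightarrow> 'a \<Rightarrow> real ^ 'n \<Rightarrow> real \<Rightarrow> real" where
  "worst_case Q \<phi> x \<theta>h r =
     (GREATEST v. v \<in> mix_expectation Q \<phi> x ` ambiguity_set \<theta>h r)"

definition theta_lower :: "real ^ 'n \<Rightarrow> real \<Rightarrow> 'n \<Rightarrow> real" where
  "theta_lower \<theta>h r j = max 0 (\<theta>h $ j - r)"

definition theta_upper :: "real ^ 'n \<Rightarrow> real \<Rightarrow> 'n \<Rightarrow> real" where
  "theta_upper \<theta>h r j = min 1 (\<theta>h $ j + r)"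

text \<open>Meaningful for \<open>0 \<le> \<beta> < 1\<close> and \<open>Z\<close> integrable under the probability measure \<open>P\<close>;
  the real-valued infimum is then over a set that is bounded below.\<close>

definition CVaR :: "real \<Rightarrow> 'a measure \<Rightarrow> ('a \<Rightarrow> real) \<Rightarrow> real" where
  "CVaR \<beta> P Z = (INF t\<in>UNIV. t + 1 / (1 - \<beta>) * (\<integral>\<omega>. max (Z \<omega> - t) 0 \<partial>P))"

text \<open>In the degenerate case where all lower and upper bounds coincide, this is \<open>1 - 0 / 0 = 1\<close>,
  outside the range of \<open>CVaR\<close>; \<open>risk_level_range\<close> and \<open>degenerate_weight\<close> below show that this
  is the only exception and that the weight \<open>1 - (\<Sum>j. theta_lower \<theta>h r j)\<close> is then \<open>0\<close>.\<close>

definition risk_level :: "real ^ 'n \<Rightarrow> real \<Rightarrow> real" where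
  "risk_level \<theta>h r =
     1 - (1 - (\<Sum>j\<in>UNIV. theta_lower \<theta>h r j)) /
         (\<Sum>j\<in>UNIV. theta_upper \<theta>h r j - theta_lower \<theta>h r j)"

lemma compact_ambiguity_set: "compact (ambiguity_set \<theta>h r)"
proof -
  have "ambiguity_set \<theta>h r =
      (\<Inter>j. {\<theta>. 0 \<le> \<theta> $ j}) \<inter> {\<theta>. (\<Sum>j\<in>UNIV. \<theta> $ j) = 1} \<inter> {\<theta>. infnorm (\<theta> - \<theta>h) \<le> r}"
    by (auto simp: ambiguity_set_def prob_simplex_def)
  moreover have "closed \<dots>"
    by (intro closed_Int closed_INT ballI closed_Collect_le closed_Collect_eq
        continuous_intros continuous_on_infnorm)
  ultimately have "closed (ambiguity_set \<theta>h r)"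
    by simp
  moreover have "ambiguity_set \<theta>h r \<subseteq> cbox 0 1"
  proof
    fix \<theta> assume "\<theta> \<in> ambiguity_set \<theta>h r"
    then have nn: "0 \<le> \<theta> $ j" and s: "(\<Sum>j\<in>UNIV. \<theta> $ j) = 1" for j
      by (auto simp: ambiguity_set_def prob_simplex_def)
    have "\<theta> $ j \<le> 1" for j
      using member_le_sum[of j UNIV "\<lambda>j. \<theta> $ j"] nn s by simp
    then show "\<theta> \<in> cbox 0 1"
      using nn by (simp add: mem_box_cart)
  qed
  ultimately show ?thesis
    using bounded_cbox bounded_subset compact_eq_bounded_closed by blast
qed

lemma worst_case_is_max:
  assumes "\<theta>h \<in> prob_simplex" and "0 \<le> r"
  shows "worst_case Q \<phi> x \<theta>h r \<in> mix_expectation Q \<phi> x ` ambiguity_set \<theta>h r"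
    and "\<And>\<theta>. \<theta> \<in> ambiguity_set \<theta>h r \<Longrightarrow> mix_expectation Q \<phi> x \<theta> \<le> worst_case Q \<phi> x \<theta>h r"
proof -
  have "\<theta>h \<in> ambiguity_set \<theta>h r"
    using assms by (simp add: ambiguity_set_def infnorm_0)
  moreover have "continuous_on (ambiguity_set \<theta>h r) (mix_expectation Q \<phi> x)"
    unfolding mix_expectation_def by (intro continuous_intros)
  ultimately obtain \<theta>m where m: "\<theta>m \<in> ambiguity_set \<theta>h r"
      "\<And>\<theta>. \<theta> \<in> ambiguity_set \<theta>h r \<Longrightarrow> mix_expectation Q \<phi> x \<theta> \<le> mix_expectation Q \<phi> x \<theta>m"
    using continuous_attains_sup[OF compact_ambiguity_set, of \<theta>h r "mix_expectation Q \<phi> x"]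
    by blast
  have eq: "worst_case Q \<phi> x \<theta>h r = mix_expectation Q \<phi> x \<theta>m"
    unfolding worst_case_def by (rule Greatest_equality) (use m in auto)
  show "worst_case Q \<phi> x \<theta>h r \<in> mix_expectation Q \<phi> x ` ambiguity_set \<theta>h r"
    using m eq by simp
  show "\<And>\<theta>. \<theta> \<in> ambiguity_set \<theta>h r \<Longrightarrow> mix_expectation Q \<phi> x \<theta> \<le> worst_case Q \<phi> x \<theta>h r"
    using m eq by simp
qed

lemma theta_bounds:
  assumes "\<theta>h \<in> prob_simplex" and "0 \<le> r"
  shows "theta_lower \<theta>h r j \<le> \<theta>h $ j" and "\<theta>h $ j \<le> theta_upper \<theta>h r j"
proof -
  have nn: "0 \<le> \<theta>h $ i" and s: "(\<Sum>j\<in>UNIV. \<theta>h $ j) = 1" for i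
    using assms by (auto simp: prob_simplex_def)
  have "\<theta>h $ j \<le> 1"
    using member_le_sum[of j UNIV "\<lambda>j. \<theta>h $ j"] nn s by simp
  then show "theta_lower \<theta>h r j \<le> \<theta>h $ j" "\<theta>h $ j \<le> theta_upper \<theta>h r j"
    using assms(2) nn[of j] by (auto simp: theta_lower_def theta_upper_def)
qed

lemma degenerate_weight:
  fixes \<theta>h :: "real ^ 'n"
  assumes "\<theta>h \<in> prob_simplex" and "0 \<le> r"
    and "(\<Sum>j\<in>UNIV. theta_upper \<theta>h r j - theta_lower \<theta>h r j) = 0"
  shows "(\<Sum>j\<in>UNIV. theta_lower \<theta>h r j) = 1"
proof -
  have "theta_lower \<theta>h r j \<le> theta_upper \<theta>h r j" for j
    using theta_bounds[OF assms(1,2), of j] by linarith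
  then have "theta_upper \<theta>h r j - theta_lower \<theta>h r j = 0" for j
    using assms(3) by (subst (asm) sum_nonneg_eq_0_iff) auto
  then have "theta_lower \<theta>h r j = \<theta>h $ j" for j
    using theta_bounds[OF assms(1,2), of j] by (simp add: order_antisym)
  then show ?thesis
    using assms(1) by (simp add: prob_simplex_def)
qed

lemma risk_level_range:
  fixes \<theta>h :: "real ^ 'n"
  assumes "\<theta>h \<in> prob_simplex" and "0 \<le> r"
    and ne: "(\<Sum>j\<in>UNIV. theta_upper \<theta>h r j - theta_lower \<theta>h r j) \<noteq> 0"
  shows "0 \<le> risk_level \<theta>h r" and "risk_level \<theta>h r < 1"
proof -
  let ?l = "\<Sum>j\<in>UNIV. theta_lower \<theta>h r j" and ?u = "\<Sum>j\<in>UNIV. theta_upper \<theta>h r j"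
  note b = theta_bounds[OF assms(1,2)]
  have s: "(\<Sum>j\<in>UNIV. \<theta>h $ j) = 1" and nn: "\<And>j. 0 \<le> \<theta>h $ j"
    using assms(1) by (auto simp: prob_simplex_def)
  have u: "1 \<le> ?u" and l: "?l \<le> 1"
    using sum_mono[of UNIV "\<lambda>j. \<theta>h $ j" "theta_upper \<theta>h r"]
      sum_mono[of UNIV "theta_lower \<theta>h r" "\<lambda>j. \<theta>h $ j"] b s by auto
  have d: "?u - ?l > 0"
    using ne u l by (simp add: sum_subtractf)
  have "?l \<noteq> 1"
  proof
    assume "?l = 1"
    then have "(\<Sum>j\<in>UNIV. \<theta>h $ j - theta_lower \<theta>h r j) = 0"
      using s by (simp add: sum_subtractf)
    then have eq: "\<theta>h $ j = theta_lower \<theta>h r j" for j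
      using b by (subst (asm) sum_nonneg_eq_0_iff) auto
    obtain k where "\<theta>h $ k \<noteq> 0"
      using s by (metis sum.neutral zero_neq_one)
    then have "r = 0"
      using eq[of k] nn[of k] assms(2) unfolding theta_lower_def by linarith
    then have "theta_upper \<theta>h r j = theta_lower \<theta>h r j" for j
      using eq[of j] b(2)[of j] unfolding theta_upper_def by linarith
    then show False
      using ne by simp
  qed
  then have "?l < 1"
    using l by simp
  then show "0 \<le> risk_level \<theta>h r" "risk_level \<theta>h r < 1"
    using d u by (simp_all add: risk_level_def sum_subtractf)
qed

end

theory Submission
  imports Defs
begin

text \<open>The ambiguity set is the box \<open>l \<le> \<theta> \<le> u\<close> cut by \<open>(\<Sum>j. \<theta> $ j) = 1\<close>. Substituting \<open>\<theta> = l + w\<close>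
  leaves a continuous knapsack problem: maximise \<open>\<Sum>j. w j * c j\<close> over \<open>0 \<le> w \<le> d\<close> with
  \<open>(\<Sum>j. w j) = s\<close>, where \<open>c j\<close> is the \<open>j\<close>-th expectation, \<open>d = u - l\<close> and \<open>s = 1 - (\<Sum>j. l j)\<close>.
  Its dual is the minimisation of \<open>s * t + (\<Sum>j. d j * max (c j - t) 0)\<close> over \<open>t\<close>, which is \<open>s\<close> times
  the Rockafellar--Uryasev formula for the CVaR; a weighted quantile \<open>t\<close> of \<open>c\<close> together with the
  greedy \<open>w\<close> certifies that there is no duality gap.\<close>

text \<open>The least value \<open>t\<close> of \<open>c\<close> on \<open>A\<close> whose strict
  upper tail weighs at most \<open>s\<close> works: its closed upper tail is either all of
  \<open>A\<close> or the strict upper tail of the next smaller value, which weighs more than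
  \<open>s\<close> by minimality.\<close>

lemma weighted_upper_quantile:
  fixes c d :: "'i \<Rightarrow> real"
  assumes "finite A" and "A \<noteq> {}" and "0 \<le> s" and "s \<le> sum d A"
  obtains t where "sum d {j \<in> A. c j > t} \<le> s" and "s \<le> sum d {j \<in> A. c j \<ge> t}"
proof -
  define T where "T = {t \<in> c ` A. sum d {j \<in> A. c j > t} \<le> s}"
  \<comment> \<open>The largest value has an empty strict upper tail, so \<open>T\<close> is
    nonempty.\<close>
  have "{j \<in> A. c j > Max (c ` A)} = {}"
    using assms(1) by (auto simp: not_less)
  then have "sum d {j \<in> A. c j > Max (c ` A)} \<le> s"
    using assms(3) by (simp only: sum.empty)
  then have "Max (c ` A) \<in> T"
    using assms(1,2) unfolding T_def by (simp del: Max_less_iff)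
  moreover have "finite T"
    using assms(1) by (simp add: T_def)
  ultimately have t: "Min T \<in> T" and t_le: "\<And>t'. t' \<in> T \<Longrightarrow> Min T \<le> t'"
    by (auto intro: Min_in)
  have "s \<le> sum d {j \<in> A. c j \<ge> Min T}"
  proof (cases "\<exists>j\<in>A. c j < Min T")
    case False
    then have "{j \<in> A. c j \<ge> Min T} = A"
      by (auto simp: not_less)
    then show ?thesis
      using assms(4) by simp
  next
    case True
    \<comment> \<open>\<open>Max B\<close> is the value of \<open>c\<close> immediately below
      \<open>Min T\<close>.\<close>
    define B where "B = {c j | j. j \<in> A \<and> c j < Min T}"
    have B: "finite B" "B \<noteq> {}"
      using True assms(1) by (auto simp: B_def)
    have MB: "Max B \<in> c ` A" "Max B < Min T"
      using Max_in[OF B] by (auto simp: B_def)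
    have "c j \<le> Max B" if "j \<in> A" "c j < Min T" for j
      using B(1) that by (intro Max_ge) (auto simp: B_def)
    then have "{j \<in> A. c j > Max B} = {j \<in> A. c j \<ge> Min T}"
      using MB(2) by (force simp: not_le[symmetric])
    moreover have "Max B \<notin> T"
      using t_le MB(2) by fastforce
    ultimately show ?thesis
      using MB(1) by (simp add: T_def)
  qed
  with t show thesis
    by (intro that[of "Min T"]) (auto simp: T_def)
qed

text \<open>As \<open>w\<close> sums to \<open>s\<close>, subtracting \<open>s * t\<close> turns the
  left side into the sum of \<open>w j * (c j - t)\<close>, bounded term by term via
  \<open>w j * max (c j - t) 0\<close>.\<close>

lemma knapsack_weak_duality:
  fixes c d w :: "'i \<Rightarrow> real"
  assumes "\<And>j. j \<in> A \<Longrightarrow> 0 \<le> w j" and "\<And>j. j \<in> A \<Longrightarrow> w j \<le> d j" and "sum w A = s"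
  shows "(\<Sum>j\<in>A. w j * c j) \<le> s * t + (\<Sum>j\<in>A. d j * max (c j - t) 0)"
proof -
  have "w j * (c j - t) \<le> d j * max (c j - t) 0" if "j \<in> A" for j
    using assms(1,2)[OF that] by (intro order_trans[OF mult_left_mono mult_right_mono]) auto
  then have "(\<Sum>j\<in>A. w j * (c j - t)) \<le> (\<Sum>j\<in>A. d j * max (c j - t) 0)"
    by (rule sum_mono)
  then show ?thesis
    by (simp add: right_diff_distrib sum_subtractf flip: sum_distrib_right assms(3))
qed

text \<open>Complementary slackness: with \<open>t\<close> a weighted quantile, the greedy
  \<open>w\<close> turns every termwise inequality behind weak duality into an equality.\<close>

lemma knapsack_strong_duality:
  fixes c d :: "'i \<Rightarrow> real"
  assumes fin: "finite A" and "A \<noteq> {}" and d: "\<And>j. j \<in> A \<Longrightarrow> 0 \<le> d j"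
    and "0 \<le> s" and "s \<le> sum d A"
  obtains w t where "\<And>j. j \<in> A \<Longrightarrow> 0 \<le> w j" and "\<And>j. j \<in> A \<Longrightarrow> w j \<le> d j" and "sum w A = s"
    and "(\<Sum>j\<in>A. w j * c j) = s * t + (\<Sum>j\<in>A. d j * max (c j - t) 0)"
proof -
  obtain t where t: "sum d {j \<in> A. c j > t} \<le> s" "s \<le> sum d {j \<in> A. c j \<ge> t}"
    using weighted_upper_quantile[OF assms(1,2,4,5)] by blast
  define a where "a = sum d {j \<in> A. c j > t}"
  define b where "b = sum d {j \<in> A. c j = t}"
  have "{j \<in> A. c j \<ge> t} = {j \<in> A. c j > t} \<union> {j \<in> A. c j = t}"
    by auto
  then have "sum d {j \<in> A. c j \<ge> t} = a + b"
    using fin unfolding a_def b_def by (simp add: sum.union_disjoint disjoint_iff)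
  with t have s: "a \<le> s" "s \<le> a + b"
    by (simp_all add: a_def)
  \<comment> \<open>If \<open>b = 0\<close> then \<open>s = a\<close>, so \<open>q = 0\<close> is the right value there.\<close>
  define q where "q = (s - a) / b"
  have q: "0 \<le> q" "q \<le> 1" "q * b = s - a"
    using s by (auto simp: q_def divide_simps)
  \<comment> \<open>Items above \<open>t\<close> are taken fully, those at \<open>t\<close> in the
    fraction \<open>q\<close> that uses up the remaining budget \<open>s - a\<close>, those below
    not at all.\<close>
  define w where "w j = (if c j > t then d j else if c j = t then q * d j else 0)" for j
  have w: "0 \<le> w j" "w j \<le> d j" if "j \<in> A" for j
    using d[OF that] q by (auto simp: w_def mult_left_le_one_le)
  have "sum w A = (\<Sum>j\<in>A. (if c j > t then d j else 0) + (if c j = t then q * d j else 0))"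
    by (intro sum.cong) (auto simp: w_def)
  also have "\<dots> = a + q * b"
    using fin by (simp add: sum.distrib a_def b_def sum.inter_filter sum_distrib_left if_distrib[of "(*) q"] cong: if_cong)
  finally have sw: "sum w A = s"
    using q by simp
  \<comment> \<open>Ties \<open>c j = t\<close> contribute zero on both sides, whatever
    \<open>q\<close> is.\<close>
  have "(\<Sum>j\<in>A. w j * (c j - t)) = (\<Sum>j\<in>A. d j * max (c j - t) 0)"
    by (intro sum.cong) (auto simp: w_def)
  then have "(\<Sum>j\<in>A. w j * c j) = s * t + (\<Sum>j\<in>A. d j * max (c j - t) 0)"
    by (simp add: right_diff_distrib sum_subtractf flip: sum_distrib_right sw)
  with w sw show thesis
    by (rule that)
qed

text \<open>The sup-norm ball constrains each coordinate separately, and the cap 1 in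
  \<open>theta_upper\<close> excludes nothing, since nonnegative coordinates with sum 1 never exceed
  1.\<close>

lemma ambiguity_set_iff:
  fixes \<theta>h :: "real ^ 'n"
  shows "\<theta> \<in> ambiguity_set \<theta>h r \<longleftrightarrow>
    (\<Sum>j\<in>UNIV. \<theta> $ j) = 1 \<and> (\<forall>j. theta_lower \<theta>h r j \<le> \<theta> $ j \<and> \<theta> $ j \<le> theta_upper \<theta>h r j)"
proof -
  have "infnorm (\<theta> - \<theta>h) \<le> r \<longleftrightarrow> (\<forall>j. \<bar>\<theta> $ j - \<theta>h $ j\<bar> \<le> r)"
    unfolding infnorm_cart by (subst cSup_le_iff) (auto simp: full_SetCompr_eq intro!: bdd_above_finite)
  moreover have "\<theta> $ j \<le> 1" if "\<forall>j. 0 \<le> \<theta> $ j" "(\<Sum>j\<in>UNIV. \<theta> $ j) = 1" for j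
    using member_le_sum[of j UNIV "\<lambda>j. \<theta> $ j"] that by simp
  ultimately show ?thesis
    unfolding ambiguity_set_def prob_simplex_def theta_lower_def theta_upper_def
    by (auto simp: abs_le_iff algebra_simps)
qed

text \<open>Multiplying by the total weight covers the degenerate case: if the total vanishes, so
  does every \<open>a j\<close>, and both sides are 0 for any \<open>p\<close>.\<close>

lemma sum_mult_expectation_proportional_pmf:
  fixes p :: "'a::finite pmf" and a f :: "'a \<Rightarrow> real"
  assumes "\<And>j. 0 \<le> a j" and "sum a UNIV \<noteq> 0 \<Longrightarrow> \<forall>j. pmf p j = a j / sum a UNIV"
  shows "sum a UNIV * measure_pmf.expectation p f = (\<Sum>j\<in>UNIV. a j * f j)"
proof (cases "sum a UNIV = 0")
  case True
  then have "a j = 0" for j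
    using assms(1) by (simp add: sum_nonneg_eq_0_iff)
  then show ?thesis
    by simp
next
  case False
  have "measure_pmf.expectation p f = (\<Sum>j\<in>UNIV. f j * pmf p j)"
    by (rule integral_measure_pmf_real) auto
  then show ?thesis
    using assms(2) False by (simp add: sum_distrib_left mult.commute)
qed

theorem theorem2:
  fixes X :: "(real ^ 'd) set"
    and \<Xi> :: "(real ^ 'm) set"
    and Q :: "'n::finite \<Rightarrow> (real ^ 'm) measure"
    and \<phi> :: "real ^ 'd \<Rightarrow> real ^ 'm \<Rightarrow> real"
    and \<theta>h :: "real ^ 'n"
    and r :: real
    and Pl Pul :: "'n pmf"
    and x :: "real ^ 'd"
  assumes "X \<noteq> {}" and "closed X" and "convex X"
    and "\<And>j. prob_space (Q j)"
    and "\<And>j. sets (Q j) = sets (restrict_space borel \<Xi>)"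
    and "\<And>\<xi>. \<xi> \<in> \<Xi> \<Longrightarrow> continuous_on X (\<lambda>y. \<phi> y \<xi>)"
    and "\<And>y. y \<in> X \<Longrightarrow> \<phi> y \<in> borel_measurable (restrict_space borel \<Xi>)"
    and "\<And>y j. y \<in> X \<Longrightarrow> integrable (Q j) (\<phi> y)"
    and "\<theta>h \<in> prob_simplex" and "0 \<le> r"
    and "(\<Sum>i\<in>UNIV. theta_lower \<theta>h r i) \<noteq> 0 \<Longrightarrow>
           (\<forall>j. pmf Pl j = theta_lower \<theta>h r j / (\<Sum>i\<in>UNIV. theta_lower \<theta>h r i))"
    and "(\<Sum>i\<in>UNIV. theta_upper \<theta>h r i - theta_lower \<theta>h r i) \<noteq> 0 \<Longrightarrow>
           (\<forall>j. pmf Pul j = (theta_upper \<theta>h r j - theta_lower \<theta>h r j) /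
                 (\<Sum>i\<in>UNIV. theta_upper \<theta>h r i - theta_lower \<theta>h r i))"
    and "x \<in> X"
  shows "worst_case Q \<phi> x \<theta>h r =
           (\<Sum>j\<in>UNIV. theta_lower \<theta>h r j) *
             measure_pmf.expectation Pl (\<lambda>j. \<integral>\<xi>. \<phi> x \<xi> \<partial>Q j) +
           (1 - (\<Sum>j\<in>UNIV. theta_lower \<theta>h r j)) *
             CVaR (risk_level \<theta>h r) (measure_pmf Pul) (\<lambda>j. \<integral>\<xi>. \<phi> x \<xi> \<partial>Q j)"
proof -
  define l where "l = theta_lower \<theta>h r"
  define d where "d j = theta_upper \<theta>h r j - theta_lower \<theta>h r j" for j
  define c where "c j = (\<integral>\<xi>. \<phi> x \<xi> \<partial>Q j)" for j
  define s where "s = 1 - sum l UNIV"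
  note b = theta_bounds[OF assms(9,10)]
  have \<theta>h: "(\<Sum>j\<in>UNIV. \<theta>h $ j) = 1"
    using assms(9) by (simp add: prob_simplex_def)
  have l: "0 \<le> l j" for j
    by (simp add: l_def theta_lower_def)
  have d: "0 \<le> d j" for j
    using b[of j] by (simp add: d_def)
  have s: "0 \<le> s" "s \<le> sum d UNIV"
    using sum_mono[of UNIV l "\<lambda>j. \<theta>h $ j"] sum_mono[of UNIV "\<lambda>j. \<theta>h $ j" "theta_upper \<theta>h r"] b \<theta>h
    by (simp_all add: s_def d_def l_def sum_subtractf)
  obtain w t where w: "\<And>j. 0 \<le> w j" "\<And>j. w j \<le> d j" "sum w UNIV = s"
      and t: "(\<Sum>j\<in>UNIV. w j * c j) = s * t + (\<Sum>j\<in>UNIV. d j * max (c j - t) 0)"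
    using knapsack_strong_duality[of UNIV d s c] d s by auto
  define v where "v = (\<Sum>j\<in>UNIV. w j * c j)"

  have worst: "worst_case Q \<phi> x \<theta>h r = (\<Sum>j\<in>UNIV. l j * c j) + v"
    unfolding worst_case_def
  proof (rule Greatest_equality)
    have "(\<chi> j. l j + w j) \<in> ambiguity_set \<theta>h r"
      using w by (auto simp: ambiguity_set_iff sum.distrib s_def d_def l_def le_diff_eq add.commute)
    moreover have "mix_expectation Q \<phi> x (\<chi> j. l j + w j) = (\<Sum>j\<in>UNIV. l j * c j) + v"
      by (simp add: mix_expectation_def c_def v_def distrib_right sum.distrib)
    ultimately show "(\<Sum>j\<in>UNIV. l j * c j) + v \<in> mix_expectation Q \<phi> x ` ambiguity_set \<theta>h r"
      by force
  next
    fix y assume "y \<in> mix_expectation Q \<phi> x ` ambiguity_set \<theta>h r"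
    then obtain \<theta> where \<theta>: "\<theta> \<in> ambiguity_set \<theta>h r" and y: "y = (\<Sum>j\<in>UNIV. \<theta> $ j * c j)"
      by (auto simp: mix_expectation_def c_def)
    \<comment> \<open>The shift of \<open>\<theta>\<close> by \<open>l\<close> is feasible for the
      knapsack, and \<open>v\<close> equals the dual objective at \<open>t\<close>.\<close>
    have "(\<Sum>j\<in>UNIV. (\<theta> $ j - l j) * c j) \<le> v"
      unfolding v_def t using \<theta>
      by (intro knapsack_weak_duality) (auto simp: ambiguity_set_iff l_def d_def s_def sum_subtractf)
    then show "y \<le> (\<Sum>j\<in>UNIV. l j * c j) + v"
      by (simp add: y left_diff_distrib sum_subtractf)
  qed

  have first: "sum l UNIV * measure_pmf.expectation Pl c = (\<Sum>j\<in>UNIV. l j * c j)"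
    using assms(11) l by (intro sum_mult_expectation_proportional_pmf) (auto simp: l_def)

  have second: "s * CVaR (risk_level \<theta>h r) Pul c = v"
  proof (cases "sum d UNIV = 0")
    case True
    \<comment> \<open>The risk level is 1 here, outside the range of \<open>CVaR\<close>, but the
      factor \<open>s\<close> is squeezed to 0.\<close>
    then have "s = 0" and "w j = 0" for j
      using s d w by (auto simp: sum_nonneg_eq_0_iff order_antisym)
    then show ?thesis
      by (simp add: v_def)
  next
    case False
    have rl: "1 - risk_level \<theta>h r = s / sum d UNIV"
      by (simp add: risk_level_def s_def l_def d_def)
    have "s / sum d UNIV > 0"
      using risk_level_range(2)[OF assms(9,10)] False unfolding rl[symmetric] d_def by simp
    then have s0: "s > 0"
      using s by (auto simp: zero_less_divide_iff)
    have E: "sum d UNIV * measure_pmf.expectation Pul f = (\<Sum>j\<in>UNIV. d j * f j)" for f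
      using assms(12) d by (intro sum_mult_expectation_proportional_pmf) (auto simp: d_def)
    define g where
      "g t = t + 1 / (1 - risk_level \<theta>h r) * measure_pmf.expectation Pul (\<lambda>j. max (c j - t) 0)" for t
    \<comment> \<open>The factor \<open>1 / (1 - risk_level \<theta>h r)\<close> is
      \<open>sum d UNIV / s\<close>; multiplied by \<open>s\<close>, it cancels the normalisation of
      \<open>Pul\<close>.\<close>
    have g: "s * g t = s * t + (\<Sum>j\<in>UNIV. d j * max (c j - t) 0)" for t
      using s0 by (simp add: g_def rl distrib_left flip: E)
    have "g t = v / s"
      using g[of t] t s0 by (simp add: v_def field_simps)
    \<comment> \<open>Weak duality against the one primal optimum \<open>w\<close> bounds
      \<open>g\<close> from below everywhere, so the infimum is a minimum attained at
      \<open>t\<close>.\<close>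
    moreover have "v / s \<le> g t'" for t'
      using knapsack_weak_duality[of UNIV w d s c t'] w g[of t'] s0
      by (simp add: v_def divide_le_eq mult.commute)
    ultimately have "Inf (range g) = v / s"
      by (intro cInf_eq_minimum) (auto intro: range_eqI[OF sym])
    then show ?thesis
      using s0 by (simp add: CVaR_def g_def)
  qed

  show ?thesis
    using worst first second by (simp add: l_def s_def c_def [abs_def])
qed

end
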